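(* Let $r^1,\ldots,r^n\in\mathbb{Z}^n$ satisfy $6\leq |\det(r^1,\ldots,r^n)|\leq n$. Then $$\operatorname{ICR}(\operatorname{pos}\{r^1,\ldots,r^n\})\leq n+|\det(r^1,\ldots,r^n)|-3.$$
   Context: $\operatorname{pos}X$ denotes the set of all finite non-negative real linear combinations of elements of $X\subseteq\mathbb{R}^n$. $\mathbb{N}$ denotes the non-negative integers. For a pointed rational cone $C\subseteq\mathbb{R}^n$, the Hilbert basis $\mathcal{H}(C)$ is the unique minimal set of vectors in $C\cap\mathbb{Z}^n$ such that every element of $C\cap\mathbb{Z}^n$ is a non-negative integral combination of elements of the set (it is finite). The integer Carathéodory rank of $C$ is $$\operatorname{ICR}(C):=\max_{z\in C\cap\mathbb{Z}^n}\min\Big\{k : z=\sum_{i=1}^k\lambda_i h^i\text{ with }\lambda_i\in\mathbb{N},\ h^i\in\mathcal{H}(C)\text{ for all }i\in\{1,\ldots,k\}\Big\},$$ i.e. the smallest $k$ such that every integer vector in $C$ is a non-negative integral combination of at most $k$ Hilbert basis elements. *)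

theory Defs
  imports "HOL-Analysis.Analysis"
begin

definition pos :: "(real ^ 'n) set \<Rightarrow> (real ^ 'n) set" where
  "pos X = {\<Sum>x\<in>F. c x *\<^sub>R x | F c. finite F \<and> F \<subseteq> X \<and> (\<forall>x\<in>F. (c x :: real) \<ge> 0)}"

definition integer_vectors :: "(real ^ 'n) set" where
  "integer_vectors = {x. \<forall>i. x $ i \<in> \<int>}"

definition nonneg_int_combs :: "(real ^ 'n) set \<Rightarrow> (real ^ 'n) set" where
  "nonneg_int_combs H = {\<Sum>x\<in>F. real (c x) *\<^sub>R x | F c. finite F \<and> F \<subseteq> H}"

definition integrally_generates :: "(real ^ 'n) set \<Rightarrow> (real ^ 'n) set \<Rightarrow> bool" where
  "integrally_generates H C \<longleftrightarrow>
     H \<subseteq> C \<inter> integer_vectors \<and> C \<inter> integer_vectors \<subseteq> nonneg_int_combs H"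

text \<open>Minimality is with respect to inclusion. The description is well defined for pointed
  rational cones, where exactly one inclusion-minimal integral generating set exists.\<close>

definition Hilbert_basis :: "(real ^ 'n) set \<Rightarrow> (real ^ 'n) set" where
  "Hilbert_basis C =
     (THE H. integrally_generates H C \<and> (\<forall>H'. H' \<subset> H \<longrightarrow> \<not> integrally_generates H' C))"

text \<open>The maximum and the minima below exist for pointed rational cones: the Hilbert basis is
  finite there, and its cardinality bounds all the minima. Otherwise the value may be unspecified.
  The vectors h i need not be distinct and coefficients may be 0.\<close>

definition ICR :: "(real ^ 'n) set \<Rightarrow> nat" where
  "ICR C = Max ((\<lambda>z. LEAST k. \<exists>(l :: nat \<Rightarrow> nat) h.
      (\<forall>i\<in>{1..k}. h i \<in> Hilbert_basis C) \<and> z = (\<Sum>i=1..k. real (l i) *\<^sub>R h i))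
    ` (C \<inter> integer_vectors))"

end

theory Submission
  imports Defs "HOL-Computational_Algebra.Primes"
begin

text \<open>Let \<open>\<Delta> = \<bar>det (r 1, \<dots>, r n)\<bar>\<close> and let \<open>L\<close> be the lattice generated by the \<open>r i\<close>. An integer vector
\<open>z\<close> of the cone is the sum of a combination of the \<open>r i\<close> with natural coefficients, namely the
integral parts of the coordinates of \<open>z\<close>, and of an integer vector \<open>x\<close> all of whose coordinates lie in
\<open>[0, 1)\<close>. Each \<open>r i\<close> is a multiple of a single element of the Hilbert basis
(\<open>generator_multiple_of_irreducible\<close>), so the first part uses at most \<open>n\<close> elements, and it
remains to write \<open>x\<close> with at most \<open>\<Delta> - 3\<close> different ones.

Let \<open>S\<close> be the set of Hilbert basis elements that occur in one representation of \<open>x\<close>. The sum over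
a subset of \<open>S\<close> is coordinatewise at most \<open>x\<close>, so it has coordinates in \<open>[0, 1)\<close> and lies in \<open>L\<close> only
if it is \<open>0\<close>. Hence \<open>S\<close> injects into the quotient of the integer vectors by \<open>L\<close> and becomes a
zero-sum free set there: no nonempty subset has sum \<open>0\<close>. Such a set with at least three elements has
at least \<open>\<bar>S\<bar> + 3\<close> subset sums (\<open>card_zero_sum_free_add_3_le\<close>), while the quotient has at
most \<open>\<Delta>\<close> elements (\<open>card_residues_le_det\<close>). Therefore \<open>\<bar>S\<bar> \<le> \<Delta> - 3\<close>; if \<open>\<bar>S\<bar> \<le> 2\<close>, this follows from
\<open>\<Delta> \<ge> 6\<close>.

The Hilbert basis, introduced as the unique minimal generating set, is recognised as the set of
irreducible integer points of the cone (\<open>Hilbert_basis_eq_irreducibles\<close>), which generate by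
induction along a grading.\<close>

section \<open>Subset sums of zero-sum free sets\<close>

definition subset_sums :: "'a::comm_monoid_add set \<Rightarrow> 'a set" where
  "subset_sums S = (\<lambda>T. \<Sum>x\<in>T. x) ` Pow S"

lemma subset_sums_insert:
  assumes "finite S" "x \<notin> S"
  shows "subset_sums (insert x S) = subset_sums S \<union> (\<lambda>y. y + x) ` subset_sums S"
proof -
  have "(\<Sum>y\<in>insert x T. y) = (\<Sum>y\<in>T. y) + x" if "T \<subseteq> S" for T
    using that assms by (subst sum.insert) (auto simp: add.commute dest: finite_subset)
  then show ?thesis
    unfolding subset_sums_def Pow_insert image_Un image_image by (auto intro!: image_cong)
qed

lemma finite_subset_sums: "finite S \<Longrightarrow> finite (subset_sums S)"
  by (simp add: subset_sums_def)

text \<open>In a quotient group a sum of elements is a sum of classes. Since the groups needed below depend on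
the vectors \<open>r i\<close>, they are represented by a map \<open>q\<close> on the ambient group whose fibres are the
cosets of a subgroup, so that no type of cosets has to be formed: \<open>q x = q 0\<close> says that \<open>x\<close> lies
in the subgroup.\<close>

locale congruence_map =
  fixes q :: "'a::ab_group_add \<Rightarrow> 'b"
  assumes q_eq_iff: "q x = q y \<longleftrightarrow> q (x - y) = q 0"
begin

definition zero_sum_free :: "'a set \<Rightarrow> bool" where
  "zero_sum_free S \<longleftrightarrow> (\<forall>T\<subseteq>S. T \<noteq> {} \<longrightarrow> q (\<Sum>x\<in>T. x) \<noteq> q 0)"

lemma zero_sum_free_subset: "zero_sum_free S \<Longrightarrow> S' \<subseteq> S \<Longrightarrow> zero_sum_free S'"
  by (auto simp: zero_sum_free_def)

lemma q_add_right_iff: "q (x + z) = q (y + z) \<longleftrightarrow> q x = q y"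
  using q_eq_iff[of "x + z" "y + z"] q_eq_iff[of x y] by simp

lemma q_add_left_iff: "q (z + x) = q (z + y) \<longleftrightarrow> q x = q y"
  using q_add_right_iff[of x z y] by (simp add: add.commute)

text \<open>Translation by \<open>x\<close> permutes the classes of the group. If \<open>x\<close> added no new class, it would map the
finite set of classes of sums over subsets of \<open>S\<close> onto itself, and so reach the class of \<open>0\<close>; this
is a zero-sum subset containing \<open>x\<close>.\<close>

lemma card_subset_sums_insert:
  assumes "finite S" "x \<notin> S" "zero_sum_free (insert x S)"
  shows "card (q ` subset_sums S) < card (q ` subset_sums (insert x S))"
proof (rule ccontr)
  let ?Q = "q ` subset_sums S" and ?Q' = "q ` subset_sums (insert x S)"
  assume "\<not> card ?Q < card ?Q'"
  moreover have "?Q \<subseteq> ?Q'" and fin: "finite ?Q'"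
    using assms by (auto simp: subset_sums_insert finite_subset_sums)
  ultimately have eq: "?Q' = ?Q"
    by (metis card_seteq not_less)
  obtain U where U: "U \<subseteq> subset_sums S" "inj_on q U" "q ` U = ?Q"
    using subset_image_inj[of ?Q q "subset_sums S"] by auto
  have "inj_on (\<lambda>y. q (y + x)) U"
    using U(2) by (auto simp: inj_on_def q_add_right_iff)
  then have "card ((\<lambda>y. q (y + x)) ` U) = card ?Q"
    using U by (metis card_image)
  moreover have "(\<lambda>y. q (y + x)) ` U \<subseteq> ?Q"
    unfolding eq[symmetric] using U(1) assms by (auto simp: subset_sums_insert)
  ultimately have "(\<lambda>y. q (y + x)) ` U = ?Q"
    using fin eq by (metis card_subset_eq)
  moreover have "q 0 \<in> ?Q"
    by (auto simp: subset_sums_def intro!: image_eqI[of _ _ 0] image_eqI[of _ _ "{}"])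
  ultimately obtain y where "y \<in> U" "q (y + x) = q 0"
    by (metis (mono_tags, lifting) imageE)
  then obtain T where T: "T \<subseteq> S" "q ((\<Sum>y\<in>T. y) + x) = q 0"
    using U(1) unfolding subset_sums_def by blast
  have "(\<Sum>y\<in>insert x T. y) = (\<Sum>y\<in>T. y) + x"
    using T(1) assms by (subst sum.insert) (auto simp: add.commute dest: finite_subset)
  then show False
    using T assms(3) unfolding zero_sum_free_def by (metis insert_mono insert_not_empty)
qed

text \<open>This is where the bound gains over the trivial one: three elements already produce two classes more
than the four that the previous lemma guarantees. The sums \<open>0\<close>, \<open>a\<close>, \<open>b\<close>, \<open>a + b\<close> and \<open>a + b + c\<close>
are always incongruent, and \<open>c\<close>, \<open>a + c\<close>, \<open>b + c\<close> can not all fall back on these.\<close>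

lemma six_le_card_subset_sums_of_three:
  assumes "distinct [a, b, c]" "inj_on q {a, b, c}" "zero_sum_free {a, b, c}"
  shows "6 \<le> card (q ` subset_sums {a, b, c})"
proof -
  have ne: "a \<noteq> b" "a \<noteq> c" "b \<noteq> c" using assms(1) by auto
  have q_ne: "q a \<noteq> q b" "q a \<noteq> q c" "q b \<noteq> q c"
    using assms(2) ne by (auto simp: inj_on_def)
  have zs: "q (\<Sum>x\<in>T. x) \<noteq> q 0" if "T \<subseteq> {a, b, c}" "T \<noteq> {}" for T
    using assms(3) that by (auto simp: zero_sum_free_def)
  have nz: "q a \<noteq> q 0" "q b \<noteq> q 0" "q c \<noteq> q 0" "q (a + b) \<noteq> q 0" "q (a + c) \<noteq> q 0"
      "q (b + c) \<noteq> q 0" "q (a + b + c) \<noteq> q 0"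
    using zs[of "{a}"] zs[of "{b}"] zs[of "{c}"] zs[of "{a, b}"] zs[of "{a, c}"] zs[of "{b, c}"]
      zs[of "{a, b, c}"] ne by (auto simp: add.assoc)
  have sums: "subset_sums {a, b, c} = {0, a, b, c, a + b, a + c, b + c, a + b + c}"
    using ne by (auto simp: subset_sums_def Pow_insert ac_simps)
  have cancel: "q (x + z) = q x \<longleftrightarrow> q z = q 0" "q (z + x) = q x \<longleftrightarrow> q z = q 0" for x z
    using q_add_left_iff[of x z 0] q_add_right_iff[of z x 0] by simp_all
  have total: "q (a + b + c) \<notin> {q 0, q a, q b, q (a + b)}"
    using nz cancel(1)[of a "b + c"] cancel(1)[of b "a + c"] cancel(1)[of "a + b" c]
    by (auto simp: ac_simps)
  have "card {q 0, q a, q b, q (a + b), q (a + b + c)} = 5"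
    using nz q_ne total cancel[of a b] cancel[of b a] by (auto simp: ac_simps)
  moreover have "\<exists>s \<in> {c, a + c, b + c}. q s \<notin> {q 0, q a, q b, q (a + b), q (a + b + c)}"
  proof (rule ccontr)
    assume "\<not> ?thesis"
    \<comment> \<open>Every other coincidence would cancel to a zero sum or identify two of \<open>a\<close>, \<open>b\<close>, \<open>c\<close>.\<close>
    then have "q c = q (a + b)" "q (a + c) = q b" "q (b + c) = q a"
      using nz q_ne cancel[of c "a + b"] cancel[of c a] cancel[of a c] cancel[of c b]
        cancel[of b c] cancel[of "a + c" b] cancel[of "b + c" a]
        q_add_left_iff[of a b c] q_add_left_iff[of b a c]
      by (auto simp: ac_simps)
    \<comment> \<open>Adding up the last two congruences gives \<open>2 c \<equiv> 0\<close>, hence \<open>a + b + c \<equiv> 2 c \<equiv> 0\<close>.\<close>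
    have "q (a + b + c) = q (c + c)"
      using \<open>q c = q (a + b)\<close> q_add_right_iff[of "a + b" c c] by simp
    also have "\<dots> = q 0"
    proof -
      have "q (a + c + (b + c)) = q (b + a)"
        using \<open>q (a + c) = q b\<close> \<open>q (b + c) = q a\<close> q_add_right_iff q_add_left_iff by metis
      then show ?thesis
        using cancel(1)[of "b + a" "c + c"] by (simp add: ac_simps)
    qed
    finally show False using nz by simp
  qed
  ultimately obtain s where "s \<in> {c, a + c, b + c}"
    and "q s \<notin> {q 0, q a, q b, q (a + b), q (a + b + c)}"
    and "card {q 0, q a, q b, q (a + b), q (a + b + c)} = 5"
    by blast
  then have "card {q s, q 0, q a, q b, q (a + b), q (a + b + c)} = 6"
    by (subst card_insert_disjoint) auto
  moreover have "{q s, q 0, q a, q b, q (a + b), q (a + b + c)} \<subseteq> q ` subset_sums {a, b, c}"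
    using \<open>s \<in> _\<close> unfolding sums by auto
  ultimately show ?thesis
    by (metis card_mono finite_imageI finite_subset_sums finite.insertI finite.emptyI)
qed

text \<open>Start with three elements and six classes; every further element contributes at least one class.\<close>

lemma card_zero_sum_free_add_3_le:
  assumes "finite S" "inj_on q S" "zero_sum_free S" "3 \<le> card S"
  shows "card S + 3 \<le> card (q ` subset_sums S)"
proof -
  obtain T0 where "T0 \<subseteq> S" "card T0 = 3"
    using obtain_subset_with_card_n[OF assms(4)] by auto
  then obtain a b c where "T0 = {a, b, c}" "distinct [a, b, c]"
    by (auto simp: card_Suc_eq numeral_3_eq_3)
  then have base: "6 \<le> card (q ` subset_sums T0)"
    using six_le_card_subset_sums_of_three[of a b c] inj_on_subset[OF assms(2) \<open>T0 \<subseteq> S\<close>]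
      zero_sum_free_subset[OF assms(3) \<open>T0 \<subseteq> S\<close>] by simp
  have "card T + 6 \<le> card (q ` subset_sums (T0 \<union> T))"
    if "finite T" "T \<subseteq> S - T0" for T
    using that
  proof (induction T rule: finite_induct)
    case empty
    then show ?case using base by simp
  next
    case (insert x T)
    have "card (q ` subset_sums (T0 \<union> T)) < card (q ` subset_sums (insert x (T0 \<union> T)))"
      using insert \<open>T0 \<subseteq> S\<close> assms(1,3)
      by (intro card_subset_sums_insert zero_sum_free_subset[OF assms(3)])
        (auto dest: finite_subset)
    then show ?case using insert by simp
  qed
  from this[of "S - T0"] show ?thesis
    using \<open>T0 \<subseteq> S\<close> \<open>card T0 = 3\<close> assms by (simp add: card_Diff_subset finite_subset Un_absorb1)
qed

end

section \<open>The index of a sublattice is bounded by its determinant\<close>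

lemma card_image_le_if_determined:
  assumes "finite X" and "\<And>x y. x \<in> X \<Longrightarrow> y \<in> X \<Longrightarrow> g x = g y \<Longrightarrow> f x = f y"
  shows "card (f ` X) \<le> card (g ` X)"
proof -
  obtain U where U: "U \<subseteq> X" "inj_on f U" "f ` X = f ` U"
    using subset_image_inj[of "f ` X" f X] by auto
  have "inj_on g U"
    using U assms(2) by (meson inj_on_def subsetD)
  have "card (f ` X) = card (g ` U)"
    using U \<open>inj_on g U\<close> by (simp add: card_image)
  also have "\<dots> \<le> card (g ` X)"
    using U(1) assms(1) by (intro card_mono) auto
  finally show ?thesis .
qed

lemma frac_eq_frac_iff: "frac x = frac y \<longleftrightarrow> x - y \<in> \<int>" for x y :: real
proof
  assume "frac x = frac y"
  then show "x - y \<in> \<int>" by (metis frac_eqE Ints_of_int add_diff_cancel_left')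
next
  assume "x - y \<in> \<int>"
  then show "frac x = frac y" using frac_add_int_right[of "x - y" y] by simp
qed

lemma abs_Ints_obtain_nat:
  fixes x :: real
  assumes "x \<in> \<int>"
  obtains d where "\<bar>x\<bar> = real d"
proof -
  obtain k where "x = of_int k" using assms Ints_cases by blast
  then have "\<bar>x\<bar> = real (nat \<bar>k\<bar>)" by simp
  then show thesis by (rule that)
qed

lemma integer_vectors_add: "x \<in> integer_vectors \<Longrightarrow> y \<in> integer_vectors \<Longrightarrow> x + y \<in> integer_vectors"
  and integer_vectors_diff: "x \<in> integer_vectors \<Longrightarrow> y \<in> integer_vectors \<Longrightarrow> x - y \<in> integer_vectors"
  and integer_vectors_scale: "x \<in> integer_vectors \<Longrightarrow> a \<in> \<int> \<Longrightarrow> a *\<^sub>R x \<in> integer_vectors"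
  and integer_vectors_0: "0 \<in> integer_vectors"
  by (auto simp: integer_vectors_def)

lemma integer_vectors_sum:
  "(\<And>x. x \<in> X \<Longrightarrow> f x \<in> integer_vectors) \<Longrightarrow> (\<Sum>x\<in>X. f x) \<in> integer_vectors"
  by (auto simp: integer_vectors_def)

lemma det_Ints:
  fixes A :: "real^'n^'n"
  assumes "\<And>i j. A $ i $ j \<in> \<int>"
  shows "det A \<in> \<int>"
  unfolding det_def using assms by (intro Ints_sum Ints_mult Ints_prod) auto

text \<open>The vectors \<open>r i\<close> are the columns of an integral matrix \<open>A\<close>, and \<open>coord v\<close> below are the coordinates
of \<open>v\<close> with respect to them. The sublattice generated by the columns consists of the vectors with
integral coordinates.\<close>

locale integer_basis =
  fixes r :: "'n::finite \<Rightarrow> real ^ 'n"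
  assumes r_integer: "r i \<in> integer_vectors"
    and det_nonzero: "det (\<chi> i j. r j $ i) \<noteq> 0"
begin

abbreviation A :: "real ^ 'n ^ 'n" where "A \<equiv> \<chi> i j. r j $ i"

definition coord :: "real ^ 'n \<Rightarrow> real ^ 'n" where
  "coord v = matrix_inv A *v v"

lemma A_inverse: "A ** matrix_inv A = mat 1" "matrix_inv A ** A = mat 1"
proof -
  have "\<exists>B. A ** B = mat 1 \<and> B ** A = mat 1"
    using det_nonzero by (simp add: invertible_det_nz flip: invertible_def)
  then have "A ** matrix_inv A = mat 1 \<and> matrix_inv A ** A = mat 1"
    unfolding matrix_inv_def by (rule someI_ex)
  then show "A ** matrix_inv A = mat 1" "matrix_inv A ** A = mat 1" by simp_all
qed

lemma A_coord [simp]: "A *v coord v = v"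
  by (simp add: coord_def matrix_vector_mul_assoc A_inverse)

lemma coord_A [simp]: "coord (A *v v) = v"
  by (simp add: coord_def matrix_vector_mul_assoc A_inverse)

lemma linear_coord: "linear coord"
  unfolding coord_def by simp

lemmas coord_add = linear_add[OF linear_coord]
  and coord_diff = linear_diff[OF linear_coord]
  and coord_scaleR = linear_scale[OF linear_coord]
  and coord_sum = linear_sum[OF linear_coord]
  and coord_0 [simp] = linear_0[OF linear_coord]

lemma coord_inject: "coord x = coord y \<longleftrightarrow> x = y"
  by (metis A_coord)

lemma coord_r: "coord (r i) = axis i 1"
proof -
  have "r i = A *v axis i 1"
    by (simp add: matrix_vector_mult_basis column_def vec_eq_iff)
  then show ?thesis by (metis coord_A)
qed

lemma r_expansion: "v = (\<Sum>i\<in>UNIV. coord v $ i *\<^sub>R r i)"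
proof -
  have "v = A *v coord v" by simp
  also have "\<dots> = (\<Sum>i\<in>UNIV. coord v $ i *\<^sub>R r i)"
    by (simp only: matrix_mult_sum scalar_mult_eq_scaleR) (simp add: column_def)
  finally show ?thesis .
qed

lemma inj_r: "inj r"
  by (rule injI) (metis coord_r axis_eq_axis zero_neq_one)

lemma det_Ints_A: "det A \<in> \<int>"
  using r_integer by (intro det_Ints) (simp add: integer_vectors_def)

text \<open>Cramer's rule.\<close>

lemma det_replace: "det (\<chi> a b. (r(i := v)) b $ a) = coord v $ i * det A"
proof -
  have "(\<chi> a b. (r(i := v)) b $ a) = (\<chi> a b. if b = i then (A *v coord v) $ a else A $ a $ b)"
    by (simp add: vec_eq_iff)
  also have "det \<dots> = coord v $ i * det A"
    by (rule cramer_lemma)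
  finally show ?thesis .
qed

lemma det_times_coord_Ints:
  assumes "v \<in> integer_vectors"
  shows "det A * coord v $ i \<in> \<int>"
proof -
  have "det (\<chi> a b. (r(i := v)) b $ a) \<in> \<int>"
    using assms r_integer by (intro det_Ints) (auto simp: integer_vectors_def)
  then show ?thesis unfolding det_replace by (simp add: mult.commute)
qed

text \<open>The coordinates of the representative of \<open>v\<close> in the half-open parallelepiped spanned by the \<open>r i\<close>;
this labels the classes modulo the sublattice generated by the \<open>r i\<close>.\<close>

definition residue :: "real ^ 'n \<Rightarrow> real ^ 'n" where
  "residue v = (\<chi> i. frac (coord v $ i))"

lemma residue_eq_iff: "residue x = residue y \<longleftrightarrow> (\<forall>i. coord (x - y) $ i \<in> \<int>)"
  by (simp add: residue_def vec_eq_iff frac_eq_frac_iff coord_diff)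

lemma residue_eq_0_iff: "residue x = residue 0 \<longleftrightarrow> (\<forall>i. coord x $ i \<in> \<int>)"
  by (simp add: residue_eq_iff)

text \<open>Cauchy's theorem for the quotient group: by Cramer's rule \<open>\<bar>det A\<bar>\<close> annihilates
the quotient, so a nontrivial class has a finite order, and a suitable multiple of the class has
prime order.\<close>

lemma exists_prime_order:
  assumes "v \<in> integer_vectors" "residue v \<noteq> residue 0"
  obtains p w where "prime (p::nat)" "w \<in> integer_vectors" "residue w \<noteq> residue 0"
    "residue (real p *\<^sub>R w) = residue 0"
proof -
  define order where "order = (LEAST m::nat. 0 < m \<and> residue (real m *\<^sub>R v) = residue 0)"
  obtain d where d: "\<bar>det A\<bar> = real d"
    using abs_Ints_obtain_nat[OF det_Ints_A] .
  have "residue (real d *\<^sub>R v) = residue 0"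
    using det_times_coord_Ints[OF assms(1)] d
    by (auto simp: residue_eq_0_iff coord_scaleR abs_if simp flip: d split: if_splits)
  moreover have "0 < d" using d det_nonzero by (cases d) auto
  ultimately have ord: "0 < order" "residue (real order *\<^sub>R v) = residue 0"
    unfolding order_def using LeastI[of "\<lambda>m. 0 < m \<and> residue (real m *\<^sub>R v) = residue 0" d]
    by simp_all
  have "order \<noteq> 1" using ord assms(2) by auto
  then obtain p where p: "prime p" "p dvd order"
    using prime_factor_nat by blast
  then obtain k where k: "order = p * k" by (auto elim: dvdE)
  have "0 < k" "k < order" using ord(1) k prime_gt_1_nat[OF p(1)] by auto
  then have "residue (real k *\<^sub>R v) \<noteq> residue 0"
    using not_less_Least[of k "\<lambda>m. 0 < m \<and> residue (real m *\<^sub>R v) = residue 0"]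
    unfolding order_def by auto
  moreover have "residue (real p *\<^sub>R real k *\<^sub>R v) = residue 0"
    using ord(2) k by simp
  moreover have "real k *\<^sub>R v \<in> integer_vectors"
    using assms(1) by (intro integer_vectors_scale) auto
  ultimately show thesis using that p(1) by blast
qed

text \<open>Some coordinate of a vector of prime order \<open>p\<close> has the form \<open>a / p\<close> with \<open>a\<close> prime to \<open>p\<close>. Inverting
\<open>a\<close> modulo \<open>p\<close> and adding a multiple of \<open>r i\<close> turns it into \<open>1 / p\<close>. Exchanging \<open>r i\<close> for such
a vector then gives a basis of a lattice that still contains \<open>r i\<close>, with index \<open>p\<close>.\<close>

lemma exists_coord_inverse_prime:
  assumes "v \<in> integer_vectors" "residue v \<noteq> residue 0"
  obtains p w i where "prime (p::nat)" "w \<in> integer_vectors" "coord w $ i = 1 / real p"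
    "\<And>j. real p * coord w $ j \<in> \<int>"
proof -
  obtain p w where p: "prime (p::nat)" and w: "w \<in> integer_vectors" "residue w \<noteq> residue 0"
    "residue (real p *\<^sub>R w) = residue 0"
    using exists_prime_order[OF assms] .
  have p0: "real p > 0" using p prime_gt_0_nat by simp
  have pw: "real p * coord w $ j \<in> \<int>" for j
    using w(3) by (simp add: residue_eq_0_iff coord_scaleR)
  obtain i where i: "coord w $ i \<notin> \<int>"
    using w(2) by (auto simp: residue_eq_0_iff)
  obtain a where a: "real p * coord w $ i = of_int a"
    using pw Ints_cases by metis
  have "\<not> int p dvd a"
  proof
    assume "int p dvd a"
    then obtain b where "a = int p * b" ..
    then have "coord w $ i = of_int b" using a p0 by simp
    then show False using i by simp
  qed
  then have "coprime (int p) a"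
    using p by (simp add: prime_imp_coprime)
  then obtain s t where st: "s * int p + t * a = 1"
    using bezout_int[of "int p" a] by auto
  define u where "u = of_int t *\<^sub>R w + of_int s *\<^sub>R r i"
  have "u \<in> integer_vectors"
    unfolding u_def using w(1) r_integer by (intro integer_vectors_add integer_vectors_scale) auto
  moreover have "coord u $ i = 1 / real p"
  proof -
    have "real p * coord u $ i = of_int (s * int p + t * a)"
      using a by (simp add: u_def coord_add coord_scaleR coord_r algebra_simps)
    then have "real p * coord u $ i = 1" by (simp only: st of_int_1)
    then show ?thesis using p0 by (simp add: field_simps)
  qed
  moreover have "real p * coord u $ j \<in> \<int>" for j
  proof -
    have "real p * coord u $ j = of_int t * (real p * coord w $ j) + of_int s * (real p * coord (r i) $ j)"
      by (simp add: u_def coord_add coord_scaleR algebra_simps)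
    also have "\<dots> \<in> \<int>"
      by (rule Ints_add[OF Ints_mult[OF Ints_of_int pw]]) (simp add: coord_r axis_def)
    finally show ?thesis .
  qed
  ultimately show thesis using that p by blast
qed

end

text \<open>The index of the lattice generated by the \<open>r i\<close> in the lattice of all integer vectors is at most
\<open>\<bar>det A\<bar>\<close>. The proof is by induction on this determinant. If the lattice is not everything, exchange
one \<open>r i\<close> for a vector whose \<open>i\<close>-th coordinate is \<open>1 / p\<close>: this divides the determinant by \<open>p\<close>, and
every class of the larger lattice splits into at most \<open>p\<close> classes of the smaller one.\<close>

lemma (in integer_basis) card_residues_le_det:
  assumes "finite X" "X \<subseteq> integer_vectors"
  shows "real (card (residue ` X)) \<le> \<bar>det A\<bar>"
proof -
  have "real (card (integer_basis.residue r ` X)) \<le> real d"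
    if "integer_basis r" "\<bar>det (\<chi> i j. r j $ i)\<bar> = real d" for d and r :: "'n \<Rightarrow> real ^ 'n"
    using that
  proof (induction d arbitrary: r rule: less_induct)
    case (less d)
    interpret R: integer_basis r by (fact less.prems)
    show ?case
    proof (cases "\<exists>v\<in>integer_vectors. R.residue v \<noteq> R.residue 0")
      case False
      then have "R.residue ` X \<subseteq> {R.residue 0}" using assms(2) by auto
      then have "card (R.residue ` X) \<le> 1"
        using card_mono[of "{R.residue 0}" "R.residue ` X"] by simp
      also have "1 \<le> d" using less.prems(2) R.det_nonzero by (cases d) auto
      finally show ?thesis by simp
    next
      case True
      then obtain p w i where p: "prime (p::nat)" and w: "w \<in> integer_vectors"
        "R.coord w $ i = 1 / real p" "\<And>j. real p * R.coord w $ j \<in> \<int>"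
        using R.exists_coord_inverse_prime by metis
      have p1: "1 < p" using p prime_gt_1_nat by blast
      define r' where "r' = r(i := w)"
      have det': "det (\<chi> a b. r' b $ a) = R.coord w $ i * det R.A"
        unfolding r'_def by (rule R.det_replace)
      interpret R': integer_basis r'
      proof
        show "r' j \<in> integer_vectors" for j using w R.r_integer by (simp add: r'_def)
        show "det (\<chi> a b. r' b $ a) \<noteq> 0" using det' w(2) R.det_nonzero p1 by simp
      qed
      obtain d' where d': "\<bar>det R'.A\<bar> = real d'"
        using abs_Ints_obtain_nat[OF R'.det_Ints_A] .
      have "\<bar>det R'.A\<bar> * real p = \<bar>det R.A\<bar>"
        using det' w(2) p1 by (simp add: abs_mult)
      then have dd': "real d = real (d' * p)" using d' less.prems(2) by simp
      then have d_eq: "d = d' * p" by linarith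
      have "0 < d" using less.prems(2) R.det_nonzero by (cases d) auto
      then have "d' < d" using d_eq p1 by (simp add: n_less_n_mult_m)
      \<comment> \<open>Since \<open>p w\<close> lies in the smaller lattice, only the coefficient of \<open>w\<close> modulo \<open>p\<close> matters.\<close>
      let ?digit = "\<lambda>x. \<lfloor>R'.coord x $ i\<rfloor> mod int p"
      have determined: "R.residue x = R.residue y"
        if eq: "R'.residue x = R'.residue y" "?digit x = ?digit y" for x y
      proof -
        define c where "c = R'.coord (x - y)"
        have cI: "c $ j \<in> \<int>" for j using eq(1) by (simp add: R'.residue_eq_iff c_def)
        have "frac (R'.coord x $ i) = frac (R'.coord y $ i)"
          using cI[of i] by (simp add: c_def frac_eq_frac_iff R'.coord_diff)
        then have "c $ i = of_int (\<lfloor>R'.coord x $ i\<rfloor> - \<lfloor>R'.coord y $ i\<rfloor>)"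
          by (simp add: c_def R'.coord_diff frac_def algebra_simps)
        moreover have "int p dvd \<lfloor>R'.coord x $ i\<rfloor> - \<lfloor>R'.coord y $ i\<rfloor>"
          using eq(2) by (simp add: mod_eq_dvd_iff)
        ultimately obtain s where s: "c $ i = of_int s * real p"
          by (metis dvdE mult.commute of_int_mult of_int_of_nat_eq)
        have "R.coord (x - y) $ k \<in> \<int>" for k
        proof -
          have "x - y = (\<Sum>j\<in>UNIV. c $ j *\<^sub>R r' j)"
            unfolding c_def by (rule R'.r_expansion)
          then have "R.coord (x - y) $ k = (\<Sum>j\<in>UNIV. c $ j * R.coord (r' j) $ k)"
            by (simp add: R.coord_sum R.coord_scaleR)
          also have "\<dots> \<in> \<int>"
          proof (intro Ints_sum)
            fix j
            show "c $ j * R.coord (r' j) $ k \<in> \<int>"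
            proof (cases "j = i")
              case True
              have "c $ j * R.coord (r' j) $ k = of_int s * (real p * R.coord w $ k)"
                using True s by (simp add: r'_def)
              then show ?thesis using w(3)[of k] by simp
            next
              case False
              then show ?thesis using cI[of j] by (simp add: r'_def R.coord_r axis_def)
            qed
          qed
          finally show ?thesis .
        qed
        then show ?thesis by (simp add: R.residue_eq_iff)
      qed
      have "card (R.residue ` X) \<le> card ((\<lambda>x. (R'.residue x, ?digit x)) ` X)"
        by (intro card_image_le_if_determined[OF assms(1)] determined) simp_all
      also have "\<dots> \<le> card ((R'.residue ` X) \<times> {0..<int p})"
        using assms(1) p1 by (intro card_mono) auto
      also have "\<dots> = card (R'.residue ` X) * p" by (simp add: card_cartesian_product)
      also have "\<dots> \<le> d' * p"
        using less.IH[OF \<open>d' < d\<close> R'.integer_basis_axioms d'] by simp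
      finally show ?thesis by (simp only: d_eq of_nat_le_iff)
    qed
  qed
  note bound = this
  obtain d where "\<bar>det A\<bar> = real d"
    using abs_Ints_obtain_nat[OF det_Ints_A] .
  then show ?thesis using bound[OF integer_basis_axioms] by simp
qed

section \<open>The Hilbert basis of a graded cone\<close>

lemma nonneg_int_combs_single: "x \<in> H \<Longrightarrow> x \<in> nonneg_int_combs H"
  unfolding nonneg_int_combs_def by (rule CollectI, rule exI[of _ "{x}"], rule exI[of _ "\<lambda>_. 1"]) simp

lemma nonneg_int_combs_0: "0 \<in> nonneg_int_combs H"
  unfolding nonneg_int_combs_def by (rule CollectI, rule exI[of _ "{}"]) simp

lemma nonneg_int_combs_add:
  assumes "x \<in> nonneg_int_combs H" "y \<in> nonneg_int_combs H"
  shows "x + y \<in> nonneg_int_combs H"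
proof -
  obtain F c where F: "x = (\<Sum>h\<in>F. real (c h) *\<^sub>R h)" "finite F" "F \<subseteq> H"
    using assms(1) by (auto simp: nonneg_int_combs_def)
  obtain G d where G: "y = (\<Sum>h\<in>G. real (d h) *\<^sub>R h)" "finite G" "G \<subseteq> H"
    using assms(2) by (auto simp: nonneg_int_combs_def)
  define e where "e h = (if h \<in> F then c h else 0) + (if h \<in> G then d h else 0)" for h
  have "x = (\<Sum>h\<in>F \<union> G. real (if h \<in> F then c h else 0) *\<^sub>R h)"
    unfolding F(1) using F G by (intro sum.mono_neutral_cong_left) auto
  moreover have "y = (\<Sum>h\<in>F \<union> G. real (if h \<in> G then d h else 0) *\<^sub>R h)"
    unfolding G(1) using F G by (intro sum.mono_neutral_cong_left) auto
  ultimately have "x + y = (\<Sum>h\<in>F \<union> G. real (e h) *\<^sub>R h)"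
    by (simp only: e_def of_nat_add scaleR_add_left sum.distrib)
  then show ?thesis
    unfolding nonneg_int_combs_def using F G
    by (intro CollectI exI[of _ "F \<union> G"] exI[of _ e]) auto
qed

definition irreducibles :: "'a::comm_monoid_add set \<Rightarrow> 'a set" where
  "irreducibles M = {h \<in> M. h \<noteq> 0 \<and> (\<forall>x\<in>M. \<forall>y\<in>M. h = x + y \<longrightarrow> x = 0 \<or> y = 0)}"

text \<open>A grading that strictly increases under addition of nonzero elements makes every decomposition into
summands stop. It is all that is needed to identify the Hilbert basis with the irreducible
elements.\<close>

locale graded_cone =
  fixes C :: "(real ^ 'n::finite) set" and deg :: "real ^ 'n \<Rightarrow> nat"
  assumes zero_in: "0 \<in> C \<inter> integer_vectors"
    and add_in: "x \<in> C \<inter> integer_vectors \<Longrightarrow> y \<in> C \<inter> integer_vectors \<Longrightarrow> x + y \<in> C \<inter> integer_vectors"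
    and deg_less: "x \<in> C \<inter> integer_vectors \<Longrightarrow> y \<in> C \<inter> integer_vectors \<Longrightarrow> y \<noteq> 0 \<Longrightarrow> deg x < deg (x + y)"
begin

abbreviation M :: "(real ^ 'n) set" where "M \<equiv> C \<inter> integer_vectors"

lemma comb_in: "finite F \<Longrightarrow> F \<subseteq> M \<Longrightarrow> (\<Sum>h\<in>F. real (c h) *\<^sub>R h) \<in> M"
proof (induction F rule: finite_induct)
  case (insert h F)
  have "real k *\<^sub>R h \<in> M" for k
  proof (induction k)
    case 0
    then show ?case using zero_in by simp
  next
    case (Suc k)
    then show ?case using add_in[of h "real k *\<^sub>R h"] insert.prems
      by (simp add: scaleR_add_left)
  qed
  then show ?case using insert add_in by simp
qed (use zero_in in simp)

lemma irreducibles_generate: "z \<in> M \<Longrightarrow> z \<in> nonneg_int_combs (irreducibles M)"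
proof (induction "deg z" arbitrary: z rule: less_induct)
  case less
  show ?case
  proof (cases "z = 0 \<or> z \<in> irreducibles M")
    case True
    then show ?thesis using nonneg_int_combs_0 nonneg_int_combs_single by blast
  next
    case False
    then obtain x y where xy: "x \<in> M" "y \<in> M" "x \<noteq> 0" "y \<noteq> 0" "z = x + y"
      using less.prems unfolding irreducibles_def by blast
    then have "deg x < deg z" "deg y < deg z"
      using deg_less[of x y] deg_less[of y x] by (simp_all add: add.commute)
    then have "x \<in> nonneg_int_combs (irreducibles M)" "y \<in> nonneg_int_combs (irreducibles M)"
      using less.hyps xy(1,2) by blast+
    then show ?thesis unfolding xy(5) by (rule nonneg_int_combs_add)
  qed
qed

text \<open>In a combination that represents an irreducible vector, split off one summand with a positive
coefficient; the remainder has to vanish.\<close>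

lemma irreducible_in_generators:
  assumes "integrally_generates H C" "h \<in> irreducibles M"
  shows "h \<in> H"
proof -
  have h: "h \<in> M" "h \<noteq> 0" "\<And>x y. x \<in> M \<Longrightarrow> y \<in> M \<Longrightarrow> h = x + y \<Longrightarrow> x = 0 \<or> y = 0"
    using assms(2) by (auto simp: irreducibles_def)
  have HM: "H \<subseteq> M" "M \<subseteq> nonneg_int_combs H"
    using assms(1) by (auto simp: integrally_generates_def)
  then have "h \<in> nonneg_int_combs H" using h(1) by blast
  then obtain F c where F: "h = (\<Sum>x\<in>F. real (c x) *\<^sub>R x)" "finite F" "F \<subseteq> H"
    unfolding nonneg_int_combs_def by blast
  have "(\<Sum>x\<in>F. real (c x) *\<^sub>R x) \<noteq> 0" using h(2) F(1) by simp
  then obtain x where x: "x \<in> F" "real (c x) *\<^sub>R x \<noteq> 0"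
    by (meson sum.neutral)
  define c' where "c' = c(x := c x - 1)"
  have "h = real (c x) *\<^sub>R x + (\<Sum>y\<in>F - {x}. real (c y) *\<^sub>R y)"
    using F x by (simp add: sum.remove)
  also have "real (c x) *\<^sub>R x = x + real (c' x) *\<^sub>R x"
    using x(2) by (cases "c x") (simp_all add: c'_def scaleR_add_left)
  also have "(\<Sum>y\<in>F - {x}. real (c y) *\<^sub>R y) = (\<Sum>y\<in>F - {x}. real (c' y) *\<^sub>R y)"
    by (rule sum.cong) (auto simp: c'_def)
  also have "x + real (c' x) *\<^sub>R x + \<dots> = x + (\<Sum>y\<in>F. real (c' y) *\<^sub>R y)"
    using F(2) x(1) by (simp add: sum.remove add.assoc)
  finally have "h = x + (\<Sum>y\<in>F. real (c' y) *\<^sub>R y)" .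
  moreover have "x \<in> M" "(\<Sum>y\<in>F. real (c' y) *\<^sub>R y) \<in> M" "x \<noteq> 0"
    using x F HM comb_in[of F c'] by auto
  ultimately have "h = x" using h(3)[of x "\<Sum>y\<in>F. real (c' y) *\<^sub>R y"] by simp
  then show ?thesis using x F by auto
qed

text \<open>The irreducibles generate and lie in every generating set, so they are the unique minimal one.\<close>

lemma Hilbert_basis_eq_irreducibles: "Hilbert_basis C = irreducibles M"
  unfolding Hilbert_basis_def
proof (rule the_equality)
  have gen: "integrally_generates (irreducibles M) C"
    using irreducibles_generate by (auto simp: integrally_generates_def irreducibles_def)
  then show "integrally_generates (irreducibles M) C \<and>
      (\<forall>H'. H' \<subset> irreducibles M \<longrightarrow> \<not> integrally_generates H' C)"
    using irreducible_in_generators by blast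
  show "H = irreducibles M"
    if "integrally_generates H C \<and> (\<forall>H'. H' \<subset> H \<longrightarrow> \<not> integrally_generates H' C)" for H
  proof -
    have "irreducibles M \<subseteq> H"
      using that irreducible_in_generators[of H] by (intro subsetI) simp
    then show ?thesis using that gen by (metis psubsetI)
  qed
qed

end

text \<open>The bound also supplies the finiteness without which the maximum in the definition would be
meaningless.\<close>

lemma ICR_le:
  fixes b :: real
  assumes "0 \<in> C \<inter> integer_vectors"
    and "\<And>z. z \<in> C \<inter> integer_vectors \<Longrightarrow> \<exists>k. real k \<le> b \<and> (\<exists>(l :: nat \<Rightarrow> nat) h.
      (\<forall>i\<in>{1..k}. h i \<in> Hilbert_basis C) \<and> z = (\<Sum>i=1..k. real (l i) *\<^sub>R h i))"
  shows "real (ICR C) \<le> b"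
proof -
  let ?f = "\<lambda>z. LEAST k. \<exists>(l :: nat \<Rightarrow> nat) h.
      (\<forall>i\<in>{1..k}. h i \<in> Hilbert_basis C) \<and> z = (\<Sum>i=1..k. real (l i) *\<^sub>R h i)"
  have le: "real (?f z) \<le> b" if z: "z \<in> C \<inter> integer_vectors" for z
  proof -
    obtain k where k: "real k \<le> b \<and> (\<exists>(l :: nat \<Rightarrow> nat) h.
      (\<forall>i\<in>{1..k}. h i \<in> Hilbert_basis C) \<and> z = (\<Sum>i=1..k. real (l i) *\<^sub>R h i))"
      using assms(2)[OF z] ..
    have "?f z \<le> k" by (rule Least_le) (rule conjunct2[OF k])
    then show ?thesis using conjunct1[OF k] by linarith
  qed
  have "?f ` (C \<inter> integer_vectors) \<subseteq> {..nat \<lfloor>b\<rfloor>}"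
    using le by (intro image_subsetI) (simp add: le_nat_floor)
  then have "finite (?f ` (C \<inter> integer_vectors))"
    by (rule finite_subset) simp
  then have "ICR C \<in> ?f ` (C \<inter> integer_vectors)"
    unfolding ICR_def using assms(1) by (intro Max_in) auto
  then show ?thesis using le by (elim imageE) (simp only:)
qed

text \<open>An arbitrary finite index set in place of an initial segment of the naturals; the \<open>h j\<close> may repeat.\<close>

lemma enumerate_combination:
  fixes h :: "'i \<Rightarrow> real ^ 'n"
  assumes "finite J" "\<And>j. j \<in> J \<Longrightarrow> h j \<in> H"
  shows "\<exists>(l' :: nat \<Rightarrow> nat) h'. (\<forall>i\<in>{1..card J}. h' i \<in> H)
    \<and> (\<Sum>j\<in>J. real (l j) *\<^sub>R h j) = (\<Sum>i=1..card J. real (l' i) *\<^sub>R h' i)"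
proof -
  obtain b where b: "bij_betw b {1..card J} J"
    using ex_bij_betw_nat_finite_1[OF assms(1)] by blast
  then have "(\<Sum>j\<in>J. real (l j) *\<^sub>R h j) = (\<Sum>i=1..card J. real (l (b i)) *\<^sub>R h (b i))"
    by (simp add: sum.reindex_bij_betw[OF b, symmetric])
  moreover have "\<forall>i\<in>{1..card J}. h (b i) \<in> H"
    using b assms(2) by (auto simp: bij_betw_def)
  ultimately show ?thesis by (intro exI[of _ "l \<circ> b"] exI[of _ "h \<circ> b"]) simp
qed

section \<open>Integer points of a simplicial cone\<close>

context integer_basis
begin

sublocale congruence: congruence_map residue
  by unfold_locales (simp add: residue_eq_iff)

lemma pos_range_iff: "z \<in> pos (range r) \<longleftrightarrow> (\<forall>i. 0 \<le> coord z $ i)"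
proof
  assume "z \<in> pos (range r)"
  then obtain F c where F: "z = (\<Sum>x\<in>F. c x *\<^sub>R x)" "F \<subseteq> range r" "\<forall>x\<in>F. c x \<ge> 0"
    unfolding pos_def by blast
  have "coord x $ i \<ge> 0" if "x \<in> F" for x i
  proof -
    from that F(2) obtain j where "x = r j" by auto
    then show ?thesis by (simp add: coord_r axis_def)
  qed
  then show "\<forall>i. 0 \<le> coord z $ i"
    using F by (auto simp: coord_sum coord_scaleR intro!: sum_nonneg mult_nonneg_nonneg)
next
  assume nonneg: "\<forall>i. 0 \<le> coord z $ i"
  have "z = (\<Sum>i\<in>UNIV. coord z $ i *\<^sub>R r i)" by (rule r_expansion)
  also have "\<dots> = (\<Sum>x\<in>range r. coord z $ inv r x *\<^sub>R x)"
    using inj_r by (simp add: sum.reindex)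
  finally show "z \<in> pos (range r)"
    unfolding pos_def using nonneg
    by (intro CollectI exI[of _ "range r"] exI[of _ "\<lambda>x. coord z $ inv r x"]) auto
qed

text \<open>By Cramer's rule the coordinates of integer vectors are integral multiples of \<open>1 / \<bar>det A\<bar>\<close>, so
scaling their sum gives a grading of the integer points of the cone by natural numbers.\<close>

definition degree :: "real ^ 'n \<Rightarrow> nat" where
  "degree z = nat \<lfloor>\<bar>det A\<bar> * (\<Sum>i\<in>UNIV. coord z $ i)\<rfloor>"

lemma real_degree:
  assumes "z \<in> pos (range r) \<inter> integer_vectors"
  shows "real (degree z) = \<bar>det A\<bar> * (\<Sum>i\<in>UNIV. coord z $ i)"
proof -
  have "\<bar>det A\<bar> * coord z $ i \<in> \<int>" for i
    using det_times_coord_Ints[of z i] assms by (auto simp: abs_if pos_range_iff)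
  then have "\<bar>det A\<bar> * (\<Sum>i\<in>UNIV. coord z $ i) \<in> \<int>"
    by (simp add: sum_distrib_left Ints_sum)
  moreover have "0 \<le> \<bar>det A\<bar> * (\<Sum>i\<in>UNIV. coord z $ i)"
    using assms by (intro mult_nonneg_nonneg sum_nonneg) (auto simp: pos_range_iff)
  ultimately show ?thesis unfolding degree_def by (auto elim!: Ints_cases)
qed

sublocale cone: graded_cone "pos (range r)" degree
proof
  show "0 \<in> pos (range r) \<inter> integer_vectors"
    by (simp add: pos_range_iff integer_vectors_0)
  show add: "x + y \<in> pos (range r) \<inter> integer_vectors"
    if "x \<in> pos (range r) \<inter> integer_vectors" "y \<in> pos (range r) \<inter> integer_vectors" for x y
    using that by (auto simp: pos_range_iff coord_add integer_vectors_add)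
  show "degree x < degree (x + y)"
    if xy: "x \<in> pos (range r) \<inter> integer_vectors" "y \<in> pos (range r) \<inter> integer_vectors" "y \<noteq> 0" for x y
  proof -
    have "coord y \<noteq> 0" using xy(3) coord_inject[of y 0] by simp
    then obtain i where "coord y $ i \<noteq> 0" by (auto simp: vec_eq_iff)
    then have "0 < (\<Sum>i\<in>UNIV. coord y $ i)"
      using xy(2) by (intro sum_pos2[of _ i]) (auto simp: pos_range_iff less_le)
    then have "0 < \<bar>det A\<bar> * (\<Sum>i\<in>UNIV. coord y $ i)" using det_nonzero by simp
    then have "real (degree x) < real (degree (x + y))"
      using real_degree[OF xy(1)] real_degree[OF add[OF xy(1,2)]]
      by (simp add: coord_add sum.distrib distrib_left)
    then show ?thesis by simp
  qed
qed

lemma r_in_cone: "r i \<in> cone.M"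
  by (simp add: pos_range_iff r_integer coord_r axis_def)

lemma irreducible_coord_nonneg: "h \<in> irreducibles cone.M \<Longrightarrow> 0 \<le> coord h $ i"
  by (auto simp: irreducibles_def pos_range_iff)

text \<open>All coordinates of irreducibles are nonnegative, so no partial sum exceeds \<open>z\<close> in any coordinate,
provided that summands with coefficient \<open>0\<close> are discarded.\<close>

lemma decompose_into_irreducibles:
  assumes "z \<in> cone.M"
  obtains F c where "finite F" "F \<subseteq> irreducibles cone.M" "z = (\<Sum>h\<in>F. real (c h) *\<^sub>R h)"
    "\<forall>T\<subseteq>F. \<forall>i. coord (\<Sum>h\<in>T. h) $ i \<le> coord z $ i"
proof -
  obtain F c where F: "finite F" "F \<subseteq> irreducibles cone.M" "z = (\<Sum>h\<in>F. real (c h) *\<^sub>R h)"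
    using cone.irreducibles_generate[OF assms] unfolding nonneg_int_combs_def by blast
  define G where "G = {h\<in>F. 0 < c h}"
  have G: "finite G" "G \<subseteq> irreducibles cone.M" using F by (auto simp: G_def)
  have z: "z = (\<Sum>h\<in>G. real (c h) *\<^sub>R h)"
    unfolding F(3) G_def using F(1) by (intro sum.mono_neutral_right) auto
  have "coord (\<Sum>h\<in>T. h) $ i \<le> coord z $ i" if "T \<subseteq> G" for T i
  proof -
    have nonneg: "0 \<le> coord h $ i" if "h \<in> G" for h
      using that G irreducible_coord_nonneg by blast
    have "coord (\<Sum>h\<in>T. h) $ i = (\<Sum>h\<in>T. coord h $ i)" by (simp add: coord_sum)
    also have "\<dots> \<le> (\<Sum>h\<in>G. coord h $ i)"
      using that G nonneg by (intro sum_mono2) auto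
    also have "\<dots> \<le> (\<Sum>h\<in>G. real (c h) * coord h $ i)"
    proof (intro sum_mono)
      fix h assume "h \<in> G"
      then have "1 * coord h $ i \<le> real (c h) * coord h $ i"
        using nonneg by (intro mult_right_mono) (auto simp: G_def)
      then show "coord h $ i \<le> real (c h) * coord h $ i" by simp
    qed
    also have "\<dots> = coord z $ i" unfolding z by (simp add: coord_sum coord_scaleR)
    finally show ?thesis .
  qed
  then show thesis using that[OF G z] by simp
qed

text \<open>The \<open>r i\<close> need not be primitive and hence need not lie in the Hilbert basis, but each of them costs
only one Hilbert basis element: all irreducible summands of \<open>r i\<close> lie on its ray, which contains only
one irreducible vector.\<close>

lemma generator_multiple_of_irreducible:
  "\<exists>p m. p \<in> irreducibles cone.M \<and> r i = real m *\<^sub>R p"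
proof -
  obtain F c where F: "finite F" "F \<subseteq> irreducibles cone.M" "r i = (\<Sum>h\<in>F. real (c h) *\<^sub>R h)"
    and le: "\<forall>T\<subseteq>F. \<forall>j. coord (\<Sum>h\<in>T. h) $ j \<le> coord (r i) $ j"
    using decompose_into_irreducibles[OF r_in_cone[of i]] .
  have axis: "coord h $ j = 0" if "h \<in> F" "j \<noteq> i" for h j
    using le[rule_format, of "{h}" j] that irreducible_coord_nonneg[of h j] F(2)
    by (auto simp: coord_r axis_def)
  \<comment> \<open>Two irreducible vectors on the ray of \<open>r i\<close> differ by a vector of the cone.\<close>
  have not_less: "\<not> coord h $ i < coord h' $ i" if "h \<in> F" "h' \<in> F" for h h'
  proof
    assume less: "coord h $ i < coord h' $ i"
    have "0 \<le> coord (h' - h) $ j" for j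
      using less axis that by (cases "j = i") (auto simp: coord_diff)
    then have "h' - h \<in> cone.M"
      using that F(2) by (auto simp: pos_range_iff irreducibles_def intro!: integer_vectors_diff)
    moreover have "h \<in> cone.M" "h \<noteq> 0" using that F(2) by (auto simp: irreducibles_def)
    moreover have "\<And>x y. x \<in> cone.M \<Longrightarrow> y \<in> cone.M \<Longrightarrow> h' = x + y \<Longrightarrow> x = 0 \<or> y = 0"
      using that F(2) unfolding irreducibles_def by blast
    ultimately have "h' - h = 0" by (metis add.commute diff_add_cancel)
    then show False using less by simp
  qed
  have unique: "h = h'" if "h \<in> F" "h' \<in> F" for h h'
  proof -
    have "coord h $ j = coord h' $ j" for j
      using axis that not_less[of h h'] not_less[of h' h] by (cases "j = i") auto
    then show ?thesis by (metis vec_eq_iff coord_inject)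
  qed
  have "r i \<noteq> 0" using coord_r[of i] by (metis coord_0 axis_eq_0_iff zero_neq_one)
  then obtain p where "p \<in> F" using F(3) by fastforce
  then have "F = {p}" using unique by auto
  then show ?thesis using F(2,3) by auto
qed

text \<open>The coordinates of all subset sums lie in \<open>[0, 1)\<close>. So distinct elements of \<open>S\<close> are incongruent
modulo the lattice of the \<open>r i\<close>, and a subset sum in the lattice would have all its coordinates
equal to \<open>0\<close>. So \<open>S\<close> is zero-sum free in the quotient group, whose order is at most
\<open>\<bar>det A\<bar>\<close>. Sets with at most two elements are covered by \<open>6 \<le> \<bar>det A\<bar>\<close>.\<close>

lemma card_add_3_le_det:
  assumes "finite S" "S \<subseteq> irreducibles cone.M" "6 \<le> \<bar>det A\<bar>"
    and small: "\<And>T i. T \<subseteq> S \<Longrightarrow> coord (\<Sum>h\<in>T. h) $ i < 1"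
  shows "real (card S) + 3 \<le> \<bar>det A\<bar>"
proof (cases "3 \<le> card S")
  case False
  then show ?thesis using assms(3) by simp
next
  case True
  have S: "h \<in> integer_vectors" "0 \<le> coord h $ i" "coord h $ i < 1" "h \<noteq> 0" if "h \<in> S" for h i
    using that assms(2) small[of "{h}" i] by (auto simp: irreducibles_def pos_range_iff)
  have "inj_on residue S"
  proof (rule inj_onI)
    fix h h' assume h: "h \<in> S" "h' \<in> S" "residue h = residue h'"
    have "residue h = coord h" if "h \<in> S" for h
      using S[OF that] by (simp add: residue_def vec_eq_iff frac_eq)
    then show "h = h'" using h coord_inject by metis
  qed
  moreover have "congruence.zero_sum_free S"
    unfolding congruence.zero_sum_free_def
  proof (intro allI impI notI)
    fix T assume T: "T \<subseteq> S" "T \<noteq> {}" "residue (\<Sum>x\<in>T. x) = residue 0"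
    have "coord (\<Sum>x\<in>T. x) $ i = (\<Sum>x\<in>T. coord x $ i)" for i by (simp add: coord_sum)
    then have nonneg: "0 \<le> coord (\<Sum>x\<in>T. x) $ i" for i
      using S(2) T(1) by (auto intro!: sum_nonneg)
    have "coord (\<Sum>x\<in>T. x) $ i = 0" for i
    proof -
      have "frac (coord (\<Sum>x\<in>T. x) $ i) = 0" using T(3) by (simp only: residue_eq_0_iff frac_eq_0_iff)
      then show ?thesis using nonneg[of i] small[OF T(1), of i] by (metis frac_eq)
    qed
    then have sum0: "(\<Sum>x\<in>T. coord x $ i) = 0" for i by (simp add: coord_sum)
    obtain h where "h \<in> T" using T(2) by auto
    have "coord h $ i = 0" for i
      using sum0[of i] sum_nonneg_eq_0_iff[of T "\<lambda>x. coord x $ i"] T(1) S(2) \<open>h \<in> T\<close>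
        finite_subset[OF T(1) assms(1)] by blast
    then have "coord h = coord 0" by (simp add: vec_eq_iff)
    then show False using \<open>h \<in> T\<close> T(1) S(4) by (auto simp only: coord_inject)
  qed
  ultimately have "card S + 3 \<le> card (residue ` subset_sums S)"
    using congruence.card_zero_sum_free_add_3_le assms(1) True by blast
  moreover have "subset_sums S \<subseteq> integer_vectors"
    using S(1) unfolding subset_sums_def by (auto intro!: integer_vectors_sum)
  then have "real (card (residue ` subset_sums S)) \<le> \<bar>det A\<bar>"
    using card_residues_le_det finite_subset_sums assms(1) by blast
  ultimately show ?thesis by linarith
qed

text \<open>The integral parts of the coordinates are absorbed by the \<open>r i\<close>, and the rest of \<open>z\<close> lies in the
half-open parallelepiped.\<close>

lemma exists_short_combination:
  assumes "6 \<le> \<bar>det A\<bar>" "z \<in> cone.M"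
  shows "\<exists>k. real k \<le> real CARD('n) + \<bar>det A\<bar> - 3 \<and> (\<exists>(l :: nat \<Rightarrow> nat) h.
      (\<forall>i\<in>{1..k}. h i \<in> Hilbert_basis (pos (range r))) \<and> z = (\<Sum>i=1..k. real (l i) *\<^sub>R h i))"
proof -
  define fl where "fl i = nat \<lfloor>coord z $ i\<rfloor>" for i
  have z: "z \<in> integer_vectors" "0 \<le> coord z $ i" for i
    using assms(2) by (auto simp: pos_range_iff)
  define x where "x = z - (\<Sum>i\<in>UNIV. real (fl i) *\<^sub>R r i)"
  have "coord x $ i = frac (coord z $ i)" for i
    using z(2) by (simp add: x_def coord_diff coord_sum coord_scaleR coord_r axis_def if_distrib
        frac_def fl_def cong: if_cong)
  then have x: "0 \<le> coord x $ i" "coord x $ i < 1" for i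
    by (simp_all add: frac_lt_1)
  have "x \<in> integer_vectors"
    unfolding x_def using z r_integer
    by (intro integer_vectors_diff integer_vectors_sum integer_vectors_scale) auto
  then have "x \<in> cone.M" using x by (simp add: pos_range_iff)
  obtain S c where S: "finite S" "S \<subseteq> irreducibles cone.M" "x = (\<Sum>h\<in>S. real (c h) *\<^sub>R h)"
    and le: "\<forall>T\<subseteq>S. \<forall>i. coord (\<Sum>h\<in>T. h) $ i \<le> coord x $ i"
    using decompose_into_irreducibles[OF \<open>x \<in> cone.M\<close>] .
  have card_S: "real (card S) + 3 \<le> \<bar>det A\<bar>"
    using card_add_3_le_det[OF S(1,2) assms(1)] le x(2) by (metis le_less_trans)
  obtain p m where p: "\<And>i. p i \<in> irreducibles cone.M" "\<And>i. r i = real (m i) *\<^sub>R p i"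
    using generator_multiple_of_irreducible by metis
  let ?J = "(UNIV :: 'n set) <+> S"
  define h where "h = case_sum p id"
  define l where "l = case_sum (\<lambda>i. fl i * m i) c"
  have "z = (\<Sum>i\<in>UNIV. real (fl i) *\<^sub>R r i) + x" by (simp add: x_def)
  also have "\<dots> = (\<Sum>i\<in>UNIV. real (l (Inl i)) *\<^sub>R h (Inl i)) + (\<Sum>g\<in>S. real (l (Inr g)) *\<^sub>R h (Inr g))"
    unfolding S(3) by (simp add: p(2) l_def h_def)
  also have "\<dots> = (\<Sum>j\<in>?J. real (l j) *\<^sub>R h j)"
    using S(1) by (simp add: sum.Plus)
  finally have z_sum: "z = (\<Sum>j\<in>?J. real (l j) *\<^sub>R h j)" .
  have h: "h j \<in> irreducibles cone.M" if "j \<in> ?J" for j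
    using that p(1) S(2) by (auto simp: h_def)
  have card_J: "real (card ?J) \<le> real CARD('n) + \<bar>det A\<bar> - 3"
    using S(1) card_S by (simp add: card_Plus)
  from enumerate_combination[of ?J h, OF _ h, where l = l] S(1)
  have "\<exists>(l' :: nat \<Rightarrow> nat) h'. (\<forall>i\<in>{1..card ?J}. h' i \<in> irreducibles cone.M)
      \<and> z = (\<Sum>i=1..card ?J. real (l' i) *\<^sub>R h' i)"
    unfolding z_sum by simp
  with card_J show ?thesis
    unfolding cone.Hilbert_basis_eq_irreducibles by (intro exI[of _ "card ?J"] conjI)
qed

end

theorem theorem1p2:
  fixes r :: "'n::finite \<Rightarrow> real ^ 'n"
  assumes "\<And>i. r i \<in> integer_vectors"
    and "6 \<le> \<bar>det (\<chi> i j. r j $ i)\<bar>"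
    and "\<bar>det (\<chi> i j. r j $ i)\<bar> \<le> real CARD('n)"
  shows "real (ICR (pos (range r))) \<le> real CARD('n) + \<bar>det (\<chi> i j. r j $ i)\<bar> - 3"
proof -
  interpret integer_basis r
    using assms(1,2) by unfold_locales auto
  show ?thesis
    using cone.zero_in exists_short_combination[OF assms(2)] by (rule ICR_le)
qed

end
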